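(* Let $x_0=\sqrt[4]{3/5}$, let $\varepsilon$ be a real number with $0<\varepsilon\leqslant 1$, let $$U(\tau)=(7\tau^2-8\tau+2)\,\tau^2,\qquad u(x)=U\!\left(\frac{x_0-x}{x_0}\right),$$ and define $h:[0,+\infty)\to\mathbb{R}$ by $$h(x)=\begin{cases}6x^2\,(1-\varepsilon\,u(x)) & \text{if } 0\leqslant x<x_0,\\ 6x^2 & \text{if } x\geqslant x_0.\end{cases}$$ Then $h$ is a counterexample to Khabibullin's conjecture (in the formulation for non-negative non-decreasing functions, recalled in the context) for $n=2$ and $\alpha=2$. That is, $h$ is non-negative and non-decreasing on $[0,+\infty)$, the inequality $$\int_0^1\frac{h(tx)}{x}\,(1-x)\,dx\leqslant t^{2}$$ holds for all $0\leqslant t<+\infty$, but the inequality $$\int_0^{+\infty}\frac{h(t)}{t}\,\frac{dt}{1+t^{4}}\leqslant\frac{3\pi}{2}$$ does not hold.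
   Context: Khabibullin's conjecture (formulation for non-negative non-decreasing functions): let $\alpha>0$ be real and let $n\geqslant 1$ be an integer. Let $h$ be a non-negative non-decreasing function on $[0,+\infty)$. If $\int_0^1\frac{h(tx)}{x}(1-x)^{n-1}\,dx\leqslant t^{\alpha}$ for all $0\leqslant t<+\infty$, then $\int_0^{+\infty}\frac{h(t)}{t}\,\frac{dt}{1+t^{2\alpha}}\leqslant\frac{\pi}{2}\prod_{k=1}^{n-1}\bigl(1+\frac{\alpha}{k}\bigr)$. A counterexample for given $n$ and $\alpha$ is a non-negative non-decreasing function $h$ on $[0,+\infty)$ satisfying the first inequality for all $t\geqslant 0$ but not satisfying the second one. For $n=2$, $\alpha=2$ the right-hand side of the second inequality equals $\frac{\pi}{2}(1+2)=\frac{3\pi}{2}$. *)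

theory Defs
  imports "HOL-Analysis.Analysis"
begin

text \<open>
  The integrals in Khabibullin's conjecture are integrals of non-negative functions and may
  be infinite (for instance the first one at \<open>t = 0\<close> when \<open>h 0 > 0\<close>), so they are taken in
  \<open>[0, \<infinity>]\<close>. In particular an infinite second integral violates the second inequality. The
  quotients by \<open>x\<close> and \<open>t\<close> at the left end point only concern a null set.
\<close>

definition khabibullin_premise :: "nat \<Rightarrow> real \<Rightarrow> (real \<Rightarrow> real) \<Rightarrow> bool" where
  "khabibullin_premise n \<alpha> h \<longleftrightarrow>
     (\<forall>t\<ge>0. (\<integral>\<^sup>+x\<in>{0..1}. ennreal (h (t * x) / x * (1 - x) ^ (n - 1)) \<partial>lborel)
              \<le> ennreal (t powr \<alpha>))"

definition khabibullin_conclusion :: "nat \<Rightarrow> real \<Rightarrow> (real \<Rightarrow> real) \<Rightarrow> bool" where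
  "khabibullin_conclusion n \<alpha> h \<longleftrightarrow>
     (\<integral>\<^sup>+t\<in>{0..}. ennreal (h t / t * (1 / (1 + t powr (2 * \<alpha>)))) \<partial>lborel)
       \<le> ennreal (pi / 2 * (\<Prod>k = 1..n - 1. 1 + \<alpha> / real k))"

text \<open>Only the values of \<open>h\<close> on \<open>[0, \<infinity>)\<close> matter.\<close>

definition khabibullin_counterexample :: "nat \<Rightarrow> real \<Rightarrow> (real \<Rightarrow> real) \<Rightarrow> bool" where
  "khabibullin_counterexample n \<alpha> h \<longleftrightarrow>
     n \<ge> 1 \<and> \<alpha> > 0 \<and> (\<forall>x\<ge>0. h x \<ge> 0) \<and> mono_on {0..} h \<and>
     khabibullin_premise n \<alpha> h \<and> \<not> khabibullin_conclusion n \<alpha> h"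

definition x0 :: real where
  "x0 = root 4 (3 / 5)"

definition U_poly :: "real \<Rightarrow> real" where
  "U_poly \<tau> = (7 * \<tau>^2 - 8 * \<tau> + 2) * \<tau>^2"

definition u_fun :: "real \<Rightarrow> real" where
  "u_fun x = U_poly ((x0 - x) / x0)"

definition h_fun :: "real \<Rightarrow> real \<Rightarrow> real" where
  "h_fun \<epsilon> x = (if x < x0 then 6 * x^2 * (1 - \<epsilon> * u_fun x) else 6 * x^2)"

end

theory Submission
  imports Defs
begin

text \<open>
  Put \<open>a = x0\<close> and let \<open>m x = max 0 (a - x)\<close>. Since \<open>U\<close> vanishes at \<open>0\<close>, both cases of the
  definition of \<open>h\<close> are covered by \<open>h x = 6 x\<^sup>2 (1 - \<epsilon> U (m x / a))\<close>. For \<open>\<epsilon> = 0\<close> both inequalities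
  of the conjecture are equalities, so only the sign of the two perturbation terms matters.

  The polynomial \<open>U\<close> is made so that \<open>6 a\<^sup>4 x U (m x / a)\<close> is the second derivative of the
  non-negative function \<open>B x = (m x)\<^sup>4 x\<^sup>3\<close>, which vanishes to order at least three at \<open>0\<close> and at
  \<open>a\<close> (\<open>bump_deriv2_eq\<close>). Integrating by parts twice moves this second derivative to the
  kernel.

  For the kernel \<open>1 - x\<close> of the first inequality only a boundary term is left, and the integral is
  exactly \<open>t\<^sup>2 (1 - \<epsilon> (m t / a)\<^sup>4) \<le> t\<^sup>2\<close> (\<open>first_integral\<close>). For the kernel
  \<open>1 / (1 + t\<^sup>4)\<close> of the second inequality the perturbation is \<open>- \<epsilon> / a\<^sup>4\<close> times the integral of
  \<open>B\<close> against the second derivative of the kernel. For \<open>t > 0\<close> that derivative has the sign of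
  \<open>5 t\<^sup>4 - 3\<close>, hence is negative exactly for \<open>0 < t < a\<close>; this is why \<open>a\<^sup>4 = 3/5\<close>. So the perturbation is
  strictly positive (\<open>bump_deriv2_kernel_neg\<close>), and the second integral exceeds \<open>3\<pi>/2\<close>.

  That \<open>h\<close> is non-decreasing is a polynomial inequality for its derivative (\<open>h_slope_nonneg\<close>), and
  non-negativity follows from \<open>h 0 = 0\<close>.
\<close>

section \<open>The bump whose second derivative is the perturbation\<close>

definition ramp :: "real \<Rightarrow> real \<Rightarrow> real" where
  "ramp a x = max 0 (a - x)"

definition bump :: "real \<Rightarrow> real \<Rightarrow> real" where
  "bump a x = ramp a x ^ 4 * x ^ 3"

definition bump_deriv :: "real \<Rightarrow> real \<Rightarrow> real" where
  "bump_deriv a x = 3 * ramp a x ^ 4 * x ^ 2 - 4 * ramp a x ^ 3 * x ^ 3"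

definition bump_deriv2 :: "real \<Rightarrow> real \<Rightarrow> real" where
  "bump_deriv2 a x = 6 * ramp a x ^ 2 * x * (ramp a x ^ 2 - 4 * ramp a x * x + 2 * x ^ 2)"

lemma ramp_nonneg: "0 \<le> ramp a x"
  by (simp add: ramp_def)

lemma ramp_eq_0: "a \<le> x \<Longrightarrow> ramp a x = 0"
  by (simp add: ramp_def)

lemma continuous_ramp [continuous_intros]:
  "continuous F f \<Longrightarrow> continuous F (\<lambda>x. ramp a (f x))"
  unfolding ramp_def by (intro continuous_intros)

lemma continuous_on_ramp [continuous_intros]:
  "continuous_on S f \<Longrightarrow> continuous_on S (\<lambda>x. ramp a (f x))"
  unfolding ramp_def by (intro continuous_intros)

lemma DERIV_ramp_power:
  assumes "2 \<le> n"
  shows "((\<lambda>x. ramp a x ^ n) has_real_derivative - (real n * ramp a x ^ (n - 1))) (at x)"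
proof -
  consider "x < a" | "x > a" | "x = a" by linarith
  then show ?thesis
  proof cases
    case 1
    have "((\<lambda>x. (a - x) ^ n) has_real_derivative - (real n * ramp a x ^ (n - 1))) (at x)"
      using 1 by (auto intro!: derivative_eq_intros simp: ramp_def)
    then show ?thesis
      by (rule has_field_derivative_transform_within_open[where S = "{..<a}"])
         (use 1 in \<open>auto simp: ramp_def\<close>)
  next
    case 2
    have "((\<lambda>x. 0) has_real_derivative - (real n * ramp a x ^ (n - 1))) (at x)"
      using 2 assms by (simp add: ramp_def zero_power)
    then show ?thesis
      by (rule has_field_derivative_transform_within_open[where S = "{a<..}"])
         (use 2 assms in \<open>auto simp: ramp_def\<close>)
  next
    case 3
    obtain k where k: "n = Suc (Suc k)"
      using assms by (metis add_2_eq_Suc le_Suc_ex)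
    \<comment> \<open>At the corner, \<open>- (ramp a z ^ (n - 1))\<close> is a continuous slope function.\<close>
    have "isCont (\<lambda>z. - (ramp a z ^ (n - 1))) x"
      by (intro continuous_intros)
    moreover have "\<forall>z. ramp a z ^ n - ramp a x ^ n = - (ramp a z ^ (n - 1)) * (z - x)"
      using 3 k by (auto simp: ramp_def max_def algebra_simps)
    ultimately show ?thesis
      using 3 k unfolding CARAT_DERIV
      by (intro exI[of _ "\<lambda>z. - (ramp a z ^ (n - 1))"]) (auto simp: ramp_def)
  qed
qed

lemma DERIV_ramp_power_mult_power:
  assumes "2 \<le> n"
  shows "((\<lambda>x. ramp a x ^ n * x ^ k) has_real_derivative
           ramp a x ^ n * (real k * x ^ (k - 1)) - real n * ramp a x ^ (n - 1) * x ^ k) (at x)"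
  by (rule derivative_eq_intros DERIV_ramp_power[OF assms] refl)+ (simp add: algebra_simps)

lemma DERIV_bump: "(bump a has_real_derivative bump_deriv a x) (at x)"
proof -
  have "(bump a has_real_derivative
      ramp a x ^ 4 * (real 3 * x ^ (3 - 1)) - real 4 * ramp a x ^ (4 - 1) * x ^ 3) (at x)"
    unfolding bump_def[abs_def] by (rule DERIV_ramp_power_mult_power) simp
  then show ?thesis by (simp add: bump_deriv_def mult_ac)
qed

lemma DERIV_bump_deriv: "(bump_deriv a has_real_derivative bump_deriv2 a x) (at x)"
proof -
  have "bump_deriv a = (\<lambda>x. 3 * (ramp a x ^ 4 * x ^ 2) - 4 * (ramp a x ^ 3 * x ^ 3))"
    by (simp add: bump_deriv_def fun_eq_iff)
  moreover have "(\<dots> has_real_derivative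
      3 * (ramp a x ^ 4 * (real 2 * x ^ (2 - 1)) - real 4 * ramp a x ^ (4 - 1) * x ^ 2)
      - 4 * (ramp a x ^ 3 * (real 3 * x ^ (3 - 1)) - real 3 * ramp a x ^ (3 - 1) * x ^ 3)) (at x)"
    by (intro DERIV_diff DERIV_cmult DERIV_ramp_power_mult_power) simp_all
  moreover have "3 * (ramp a x ^ 4 * (real 2 * x ^ (2 - 1)) - real 4 * ramp a x ^ (4 - 1) * x ^ 2)
      - 4 * (ramp a x ^ 3 * (real 3 * x ^ (3 - 1)) - real 3 * ramp a x ^ (3 - 1) * x ^ 3)
      = bump_deriv2 a x"
    unfolding bump_deriv2_def by simp algebra
  ultimately show ?thesis by simp
qed

text \<open>
  Where \<open>ramp a x\<close> is non-zero it equals \<open>a - x\<close>, and this is the polynomial identity behind the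
  choice of \<open>U\<close>; elsewhere both sides vanish.
\<close>
lemma bump_deriv2_eq:
  assumes "a \<noteq> 0"
  shows "bump_deriv2 a x = 6 * a ^ 4 * x * U_poly (ramp a x / a)"
proof (cases "x < a")
  case True
  define w where "w = ramp a x"
  have x: "x = a - w" using True by (simp add: w_def ramp_def)
  have "a ^ 4 * U_poly (w / a) = w ^ 2 * (7 * w ^ 2 - 8 * a * w + 2 * a ^ 2)"
    using assms unfolding U_poly_def by (simp add: field_simps power2_eq_square power4_eq_xxxx)
  moreover have "w ^ 2 - 4 * w * x + 2 * x ^ 2 = 7 * w ^ 2 - 8 * a * w + 2 * a ^ 2"
    unfolding x by (simp add: algebra_simps power2_eq_square)
  ultimately show ?thesis
    unfolding bump_deriv2_def w_def[symmetric] by (simp add: mult_ac)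
next
  case False
  then show ?thesis by (simp add: bump_deriv2_def U_poly_def ramp_eq_0)
qed

section \<open>The function h\<close>

lemma x0_pos: "0 < x0"
  by (simp add: x0_def)

lemma x0_power4: "x0 ^ 4 = 3 / 5"
  by (simp add: x0_def)

lemma h_fun_eq: "h_fun \<epsilon> x = 6 * x ^ 2 * (1 - \<epsilon> * U_poly (ramp x0 x / x0))"
  using x0_pos by (simp add: h_fun_def u_fun_def ramp_def U_poly_def)

lemma h_fun_0: "h_fun \<epsilon> 0 = 0"
  by (simp add: h_fun_eq)

lemma h_fun_over_arg:
  "h_fun \<epsilon> x / x = 6 * x - \<epsilon> / x0 ^ 4 * bump_deriv2 x0 x"
  using x0_pos
  by (cases "x = 0") (simp_all add: h_fun_eq bump_deriv2_eq field_simps power2_eq_square)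

text \<open>
  Times \<open>x\<close>, this is the derivative of \<open>x\<^sup>2 (1 - \<epsilon> U (1 - x / x0))\<close> at \<open>x = x0 (1 - \<tau>)\<close>. It is affine in \<open>\<epsilon>\<close>, so only \<open>\<epsilon> = 0\<close> and \<open>\<epsilon> = 1\<close> matter, and for
  \<open>\<epsilon> = 1\<close> it factors.
\<close>
lemma h_slope_nonneg:
  fixes \<epsilon> \<tau> :: real
  assumes "0 \<le> \<epsilon>" "\<epsilon> \<le> 1" "0 \<le> \<tau>" "\<tau> \<le> 1"
  shows "0 \<le> 2 * (1 - \<epsilon> * U_poly \<tau>) + \<epsilon> * (1 - \<tau>) * (28 * \<tau> ^ 3 - 24 * \<tau> ^ 2 + 4 * \<tau>)"
proof -
  have "6 - 26 * \<tau> + 42 * \<tau> ^ 2 = 42 * (\<tau> - 13 / 42) ^ 2 + 83 / 42"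
    by (simp add: power2_eq_square algebra_simps)
  also have "\<dots> \<ge> 0" by simp
  finally have "0 \<le> (1 - \<tau>) * (2 + \<tau> * (6 - 26 * \<tau> + 42 * \<tau> ^ 2))"
    using assms by (intro mult_nonneg_nonneg[of "1 - \<tau>"] add_nonneg_nonneg[of 2]
        mult_nonneg_nonneg[of \<tau>]) auto
  then have "0 \<le> (1 - \<epsilon>) * 2 + \<epsilon> * ((1 - \<tau>) * (2 + \<tau> * (6 - 26 * \<tau> + 42 * \<tau> ^ 2)))"
    using assms by (intro add_nonneg_nonneg[of "(1 - \<epsilon>) * 2"] mult_nonneg_nonneg[of \<epsilon>]) auto
  also have "\<dots> = 2 * (1 - \<epsilon> * U_poly \<tau>) + \<epsilon> * (1 - \<tau>) * (28 * \<tau> ^ 3 - 24 * \<tau> ^ 2 + 4 * \<tau>)"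
    unfolding U_poly_def by algebra
  finally show ?thesis .
qed

lemma h_fun_mono_below_x0:
  assumes "0 \<le> \<epsilon>" "\<epsilon> \<le> 1" "0 \<le> x" "x \<le> y" "y \<le> x0"
  shows "h_fun \<epsilon> x \<le> h_fun \<epsilon> y"
proof -
  define g where "g = (\<lambda>z. 6 * z ^ 2 * (1 - \<epsilon> * U_poly (1 - z / x0)))"
  have h: "h_fun \<epsilon> z = g z" if "z \<le> x0" for z
    using that x0_pos by (simp add: h_fun_eq g_def ramp_def diff_divide_distrib)
  have "g x \<le> g y"
  proof (rule DERIV_nonneg_imp_nondecreasing[OF \<open>x \<le> y\<close>])
    fix z assume z: "x \<le> z" "z \<le> y"
    define s where "s = z / x0"
    have zs: "z = x0 * s" using x0_pos by (simp add: s_def)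
    have s: "0 \<le> s" "s \<le> 1" using z assms x0_pos by (auto simp: s_def)
    let ?D = "2 * (1 - \<epsilon> * U_poly (1 - s))
      + \<epsilon> * (1 - (1 - s)) * (28 * (1 - s) ^ 3 - 24 * (1 - s) ^ 2 + 4 * (1 - s))"
    have "(g has_real_derivative 12 * z * (1 - \<epsilon> * U_poly (1 - s))
        + 6 * z ^ 2 * (\<epsilon> * ((28 * (1 - s) ^ 3 - 24 * (1 - s) ^ 2 + 4 * (1 - s)) / x0))) (at z)"
      unfolding g_def U_poly_def s_def using x0_pos
      by (auto intro!: derivative_eq_intros) (simp add: field_simps, algebra)
    also have "12 * z * (1 - \<epsilon> * U_poly (1 - s))
        + 6 * z ^ 2 * (\<epsilon> * ((28 * (1 - s) ^ 3 - 24 * (1 - s) ^ 2 + 4 * (1 - s)) / x0))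
        = 6 * z * ?D"
      unfolding zs using x0_pos by (simp add: field_simps) algebra
    finally have "(g has_real_derivative 6 * z * ?D) (at z)" .
    moreover have "0 \<le> 6 * z * ?D"
      using h_slope_nonneg[of \<epsilon> "1 - s"] s z assms by (intro mult_nonneg_nonneg) auto
    ultimately show "\<exists>D. (g has_real_derivative D) (at z) \<and> 0 \<le> D" by blast
  qed
  then show ?thesis using h assms by auto
qed

lemma h_fun_mono:
  assumes "0 \<le> \<epsilon>" "\<epsilon> \<le> 1"
  shows "mono_on {0..} (h_fun \<epsilon>)"
proof (rule mono_onI)
  fix x y :: real
  assume "x \<in> {0..}" "y \<in> {0..}" "x \<le> y"
  have above: "h_fun \<epsilon> u \<le> h_fun \<epsilon> v" if "x0 \<le> u" "u \<le> v" for u v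
    using that x0_pos by (auto simp: h_fun_def intro!: power_mono)
  consider "y \<le> x0" | "x0 \<le> x" | "x \<le> x0" "x0 \<le> y" by linarith
  then show "h_fun \<epsilon> x \<le> h_fun \<epsilon> y"
  proof cases
    case 1
    then show ?thesis using h_fun_mono_below_x0 assms \<open>x \<in> {0..}\<close> \<open>x \<le> y\<close> by auto
  next
    case 2
    then show ?thesis using above \<open>x \<le> y\<close> by auto
  next
    case 3
    then have "h_fun \<epsilon> x \<le> h_fun \<epsilon> x0"
      using h_fun_mono_below_x0 assms \<open>x \<in> {0..}\<close> by auto
    also have "\<dots> \<le> h_fun \<epsilon> y" using above 3 by auto
    finally show ?thesis .
  qed
qed

lemma h_fun_nonneg:
  assumes "0 \<le> \<epsilon>" "\<epsilon> \<le> 1" "0 \<le> x"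
  shows "0 \<le> h_fun \<epsilon> x"
  using mono_onD[OF h_fun_mono, of \<epsilon> 0 x] assms by (simp add: h_fun_0)

section \<open>The first integral\<close>

text \<open>
  The primitive comes from integrating the bump term by parts twice: with \<open>K x = bump a (t x)\<close>,
  the function \<open>K'' x (1 - x)\<close> is the derivative of \<open>K' x (1 - x) + K x\<close>. At the ends of the
  interval only \<open>K 1\<close> survives. The factor \<open>t\<^sup>2\<close> is taken out, so that \<open>t = 0\<close> is included.
\<close>
lemma first_integral:
  assumes "0 \<le> t"
  shows "set_integrable lborel {0..1} (\<lambda>x. h_fun \<epsilon> (t * x) / x * (1 - x))" (is ?int)
    and "(LINT x:{0..1}|lborel. h_fun \<epsilon> (t * x) / x * (1 - x))
           = t ^ 2 * (1 - \<epsilon> * (ramp x0 t / x0) ^ 4)" (is ?val)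
proof -
  define f where "f = (\<lambda>x. h_fun \<epsilon> (t * x) / x * (1 - x))"
  define F where "F = (\<lambda>x. t ^ 2 * (3 * x ^ 2 - 2 * x ^ 3) - \<epsilon> / x0 ^ 4 *
    (bump_deriv x0 (t * x) * (1 - x) + t ^ 2 * x ^ 3 * ramp x0 (t * x) ^ 4))"
  have f_eq: "f = (\<lambda>x. t * (6 * (t * x) - \<epsilon> / x0 ^ 4 * bump_deriv2 x0 (t * x)) * (1 - x))"
  proof
    fix x
    have "h_fun \<epsilon> (t * x) / x = t * (h_fun \<epsilon> (t * x) / (t * x))"
      by (cases "t = 0"; cases "x = 0") (auto simp: h_fun_0)
    then show "f x = t * (6 * (t * x) - \<epsilon> / x0 ^ 4 * bump_deriv2 x0 (t * x)) * (1 - x)"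
      unfolding f_def h_fun_over_arg by simp
  qed
  have dB: "((\<lambda>x. bump_deriv x0 (t * x)) has_real_derivative bump_deriv2 x0 (t * x) * t) (at x)"
    for x
    by (rule DERIV_chain2[OF DERIV_bump_deriv]) (auto intro!: derivative_eq_intros)
  have dR: "((\<lambda>x. ramp x0 (t * x) ^ 4) has_real_derivative - (real 4 * ramp x0 (t * x) ^ (4 - 1)) * t)
    (at x)" for x
    by (rule DERIV_chain2[OF DERIV_ramp_power]) (auto intro!: derivative_eq_intros)
  have dF: "(F has_real_derivative f x) (at x)" for x
    unfolding F_def f_eq
    by (rule derivative_eq_intros dB dR refl)+ (simp add: bump_deriv_def, algebra)
  have cont: "continuous_on {0..1} f"
    unfolding f_eq bump_deriv2_def by (intro continuous_intros)
  have "integrable lborel (\<lambda>x. indicator {0..1} x *\<^sub>R f x)"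
    using borel_integrable_atLeastAtMost'[OF cont] by (simp add: set_integrable_def)
  then show ?int by (simp add: set_integrable_def f_def)
  have "(LINT x:{0..1}|lborel. f x) = F 1 - F 0"
    unfolding set_lebesgue_integral_def
    by (rule integral_FTC_Icc[OF _ _ cont])
       (auto intro: has_field_derivative_at_within dF
          simp: has_real_derivative_iff_has_vector_derivative[symmetric])
  also have "\<dots> = t ^ 2 * (1 - \<epsilon> * (ramp x0 t / x0) ^ 4)"
    unfolding F_def bump_deriv_def by (simp add: algebra_simps power_divide)
  finally show ?val by (simp add: f_def)
qed

section \<open>The second integral\<close>

text \<open>For \<open>\<epsilon> = 0\<close> the value is \<open>3\<pi>/2\<close>, with primitive \<open>3 arctan (t\<^sup>2)\<close>.\<close>
lemma unperturbed_second_integral: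
  shows "set_integrable lborel {0..} (\<lambda>t::real. 6 * t / (1 + t ^ 4))" (is ?int)
    and "(LINT t:{0..}|lborel. 6 * t / (1 + t ^ 4)) = 3 * pi / 2" (is ?val)
proof -
  have "(\<integral>\<^sup>+ t. ennreal (6 * t / (1 + t ^ 4)) * indicator {0..} t \<partial>lborel)
          = ennreal (3 * (pi / 2) - 3 * arctan (0 ^ 2))"
  proof (rule nn_integral_FTC_atLeast)
    fix t :: real
    show "((\<lambda>t. 3 * arctan (t ^ 2)) has_real_derivative 6 * t / (1 + t ^ 4)) (at t)"
      by (auto intro!: derivative_eq_intros simp: field_simps)
    have "filterlim (\<lambda>t::real. t ^ 2) at_top at_top"
      by (intro filterlim_pow_at_top filterlim_ident) simp
    then have "((\<lambda>t::real. arctan (t ^ 2)) \<longlongrightarrow> pi / 2) at_top"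
      by (rule filterlim_compose[OF tendsto_arctan_at_top])
    then show "((\<lambda>t::real. 3 * arctan (t ^ 2)) \<longlongrightarrow> 3 * (pi / 2)) at_top"
      by (intro tendsto_intros)
  qed auto
  then have nn: "(\<integral>\<^sup>+ t. ennreal (indicator {0..} t *\<^sub>R (6 * t / (1 + t ^ 4))) \<partial>lborel)
                   = ennreal (3 * pi / 2)"
    by (auto intro!: nn_integral_cong simp: indicator_def elim!: trans[rotated])
  have "has_bochner_integral lborel (\<lambda>t::real. indicator {0..} t *\<^sub>R (6 * t / (1 + t ^ 4)))
          (3 * pi / 2)"
    by (rule has_bochner_integral_nn_integral[OF _ _ _ nn]) (auto simp: indicator_def)
  then show ?int ?val
    unfolding set_integrable_def set_lebesgue_integral_def
    by (auto simp: has_bochner_integral_iff)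
qed

definition kernel_deriv :: "real \<Rightarrow> real" where
  "kernel_deriv t = - 4 * t ^ 3 / (1 + t ^ 4) ^ 2"

definition kernel_deriv2 :: "real \<Rightarrow> real" where
  "kernel_deriv2 t = 4 * t ^ 2 * (5 * t ^ 4 - 3) / (1 + t ^ 4) ^ 3"

lemma one_plus_power4_pos: "0 < 1 + (t::real) ^ 4"
  by (simp add: add_pos_nonneg)

lemma DERIV_kernel: "((\<lambda>t. 1 / (1 + t ^ 4)) has_real_derivative kernel_deriv t) (at t)"
  using one_plus_power4_pos[of t] unfolding kernel_deriv_def
  by (auto intro!: derivative_eq_intros simp: power2_eq_square)

lemma DERIV_kernel_deriv: "(kernel_deriv has_real_derivative kernel_deriv2 t) (at t)"
proof -
  define q where "q = 1 + t ^ 4"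
  have q: "q \<noteq> 0" using one_plus_power4_pos[of t] by (simp add: q_def)
  have num: "((\<lambda>t. - 4 * t ^ 3) has_real_derivative - 12 * t ^ 2) (at t)"
    by (auto intro!: derivative_eq_intros)
  have den: "((\<lambda>t. (1 + t ^ 4) ^ 2) has_real_derivative 2 * q * (4 * t ^ 3)) (at t)"
    unfolding q_def by (auto intro!: derivative_eq_intros)
  have "(kernel_deriv has_real_derivative
      (- 12 * t ^ 2 * q ^ 2 - - 4 * t ^ 3 * (2 * q * (4 * t ^ 3))) / (q ^ 2 * q ^ 2)) (at t)"
    unfolding kernel_deriv_def[abs_def]
    using DERIV_divide[OF num den] q by (simp add: q_def)
  moreover have "(- 12 * t ^ 2 * q ^ 2 - - 4 * t ^ 3 * (2 * q * (4 * t ^ 3))) / (q ^ 2 * q ^ 2)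
      = kernel_deriv2 t"
  proof -
    have "- 12 * t ^ 2 * q ^ 2 - - 4 * t ^ 3 * (2 * q * (4 * t ^ 3))
        = q * (4 * t ^ 2 * (5 * t ^ 4 - 3))"
      unfolding q_def by algebra
    moreover have "q ^ 2 * q ^ 2 = q * q ^ 3" by algebra
    ultimately show ?thesis
      using q unfolding kernel_deriv2_def q_def[symmetric] by simp
  qed
  ultimately show ?thesis by simp
qed

lemma continuous_on_bump_deriv2_kernel:
  "continuous_on S (\<lambda>t. bump_deriv2 a t * (1 / (1 + t ^ 4)))"
  unfolding bump_deriv2_def
  by (intro continuous_intros ballI) (metis less_irrefl one_plus_power4_pos)

text \<open>
  Two integrations by parts replace the integrand by \<open>bump x0 t * kernel_deriv2 t\<close>; the boundary
  terms vanish because the bump and its derivative are zero at both ends. The new integrand is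
  negative in the interior of the interval, since \<open>5 t\<^sup>4 < 5 x0\<^sup>4 = 3\<close> there.
\<close>
lemma bump_deriv2_kernel_neg:
  "(LINT t:{0..x0}|lborel. bump_deriv2 x0 t * (1 / (1 + t ^ 4))) < 0"
proof -
  define \<phi> where "\<phi> = (\<lambda>t::real. 1 / (1 + t ^ 4))"
  define f where "f = (\<lambda>t. bump_deriv2 x0 t * \<phi> t)"
  define g where "g = (\<lambda>t. bump x0 t * kernel_deriv2 t)"
  define F where "F = (\<lambda>t. bump_deriv x0 t * \<phi> t - bump x0 t * kernel_deriv t)"
  have dF: "(F has_real_derivative f t - g t) (at t)" for t
    unfolding F_def f_def g_def
    by (rule derivative_eq_intros DERIV_bump DERIV_bump_deriv DERIV_kernel_deriv
          DERIV_kernel[folded \<phi>_def] refl)+ simp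
  have F0: "F 0 = 0" "F x0 = 0"
    by (simp_all add: F_def bump_def bump_deriv_def ramp_eq_0)
  have "((\<lambda>t. f t - g t) has_integral (F x0 - F 0)) {0..x0}"
    using x0_pos dF
    by (intro fundamental_theorem_of_calculus)
       (auto simp: has_real_derivative_iff_has_vector_derivative[symmetric]
          intro: has_field_derivative_at_within)
  then have fg: "((\<lambda>t. f t - g t) has_integral 0) {0..x0}"
    by (simp add: F0)
  have cf: "continuous_on {0..x0} f"
    unfolding f_def \<phi>_def by (rule continuous_on_bump_deriv2_kernel)
  have cg: "continuous_on {0..x0} g"
    unfolding g_def bump_def kernel_deriv2_def
    by (intro continuous_intros ballI) (metis less_irrefl one_plus_power4_pos power_not_zero)
  have sign: "5 * t ^ 4 - 3 < 0" if "0 \<le> t" "t < x0" for t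
    using power_strict_mono[of t x0 4] that x0_power4 by simp
  have g_nonpos: "g t \<le> 0" if "t \<in> {0..x0}" for t
  proof (cases "t = x0")
    case False
    then show ?thesis
      using that sign[of t] one_plus_power4_pos[of t] ramp_nonneg[of x0 t]
      unfolding g_def bump_def kernel_deriv2_def
      by (intro mult_nonneg_nonpos divide_nonpos_pos) auto
  qed (simp add: g_def bump_def ramp_eq_0)
  have g_mid: "g (x0 / 2) < 0"
    using sign[of "x0 / 2"] x0_pos one_plus_power4_pos[of "x0 / 2"]
    unfolding g_def bump_def kernel_deriv2_def
    by (intro mult_pos_neg divide_neg_pos) (auto simp: ramp_def)
  have gi: "g integrable_on {0..x0}"
    by (rule integrable_continuous_interval[OF cg])
  have "integral {0..x0} g \<noteq> 0"
  proof
    assume "integral {0..x0} g = 0"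
    then have "((\<lambda>t. - g t) has_integral 0) (cbox 0 x0)"
      using has_integral_neg[OF integrable_integral[OF gi]] by simp
    then have "- g (x0 / 2) = 0"
      using cg g_nonpos x0_pos
      by (intro has_integral_0_cbox_imp_0[where f = "\<lambda>t. - g t" and a = 0 and b = x0])
         (auto intro!: continuous_intros)
    with g_mid show False by simp
  qed
  moreover have "integral {0..x0} g \<le> 0"
    using integral_nonneg[OF integrable_neg[OF gi]] g_nonpos by simp
  ultimately have "integral {0..x0} g < 0" by simp
  moreover have "integral {0..x0} f = integral {0..x0} g"
    using has_integral_add[OF fg integrable_integral[OF gi]] by (simp add: integral_unique)
  moreover have "(LINT t:{0..x0}|lborel. f t) = integral {0..x0} f"
    by (rule set_borel_integral_eq_integral(2)) (rule borel_integrable_atLeastAtMost'[OF cf])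
  ultimately show ?thesis by (simp add: f_def \<phi>_def)
qed

lemma second_integral:
  assumes "0 < \<epsilon>"
  shows "set_integrable lborel {0..} (\<lambda>t. h_fun \<epsilon> t / t * (1 / (1 + t ^ 4)))" (is ?int)
    and "3 * pi / 2 < (LINT t:{0..}|lborel. h_fun \<epsilon> t / t * (1 / (1 + t ^ 4)))" (is ?val)
proof -
  define f where "f = (\<lambda>t. bump_deriv2 x0 t * (1 / (1 + t ^ 4)))"
  have split: "(\<lambda>t. h_fun \<epsilon> t / t * (1 / (1 + t ^ 4)))
                 = (\<lambda>t. 6 * t / (1 + t ^ 4) - \<epsilon> / x0 ^ 4 * f t)"
    unfolding h_fun_over_arg f_def by (simp add: left_diff_distrib diff_divide_distrib)
  \<comment> \<open>The perturbation is supported in \<open>[0, x0]\<close>.\<close>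
  have supp: "(\<lambda>t. indicator {0..} t *\<^sub>R f t) = (\<lambda>t. indicator {0..x0} t *\<^sub>R f t)"
    by (auto simp: fun_eq_iff f_def bump_deriv2_def ramp_eq_0 indicator_def)
  have "set_integrable lborel {0..x0} f"
    unfolding f_def by (rule borel_integrable_atLeastAtMost'[OF continuous_on_bump_deriv2_kernel])
  then have fi: "set_integrable lborel {0..} f"
    unfolding set_integrable_def supp .
  then have cfi: "set_integrable lborel {0..} (\<lambda>t. \<epsilon> / x0 ^ 4 * f t)"
    by (rule set_integrable_mult_right)
  show ?int
    unfolding split by (rule set_integral_diff(1)[OF unperturbed_second_integral(1) cfi])
  have "(LINT t:{0..}|lborel. f t) < 0"
    using bump_deriv2_kernel_neg unfolding set_lebesgue_integral_def supp by (simp add: f_def)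
  then have "\<epsilon> / x0 ^ 4 * (LINT t:{0..}|lborel. f t) < 0"
    using assms x0_pos by (intro mult_pos_neg) auto
  then show ?val
    unfolding split set_integral_diff(2)[OF unperturbed_second_integral(1) cfi]
      set_integral_mult_right unperturbed_second_integral(2) by linarith
qed

section \<open>The counterexample\<close>

lemma set_nn_integral_eq_set_integral:
  fixes f :: "'a \<Rightarrow> real"
  assumes "set_integrable M A f" "\<And>x. x \<in> A \<Longrightarrow> 0 \<le> f x"
  shows "(\<integral>\<^sup>+x\<in>A. ennreal (f x) \<partial>M) = ennreal (LINT x:A|M. f x)"
proof -
  have "(\<integral>\<^sup>+x\<in>A. ennreal (f x) \<partial>M) = (\<integral>\<^sup>+x. ennreal (indicator A x *\<^sub>R f x) \<partial>M)"
    by (intro nn_integral_cong) (auto simp: indicator_def)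
  also have "\<dots> = ennreal (LINT x:A|M. f x)"
    using assms unfolding set_integrable_def set_lebesgue_integral_def
    by (intro nn_integral_eq_integral) (auto simp: indicator_def)
  finally show ?thesis .
qed

theorem theorem3p1:
  fixes \<epsilon> :: real
  assumes "0 < \<epsilon>" and "\<epsilon> \<le> 1"
  shows "khabibullin_counterexample 2 2 (h_fun \<epsilon>) \<and>
    (\<forall>x\<ge>0. 0 \<le> h_fun \<epsilon> x) \<and>
    mono_on {0..} (h_fun \<epsilon>) \<and>
    (\<forall>t\<ge>0. set_integrable lborel {0..1} (\<lambda>x. h_fun \<epsilon> (t * x) / x * (1 - x)) \<and>
       (LINT x:{0..1}|lborel. h_fun \<epsilon> (t * x) / x * (1 - x)) \<le> t^2) \<and>
    set_integrable lborel {0..} (\<lambda>t. h_fun \<epsilon> t / t * (1 / (1 + t^4))) \<and>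
    \<not> (LINT t:{0..}|lborel. h_fun \<epsilon> t / t * (1 / (1 + t^4))) \<le> 3 * pi / 2"
proof -
  have nonneg: "0 \<le> h_fun \<epsilon> x" if "0 \<le> x" for x
    using h_fun_nonneg assms that by simp
  have mono: "mono_on {0..} (h_fun \<epsilon>)"
    using h_fun_mono assms by simp
  have first_le: "(LINT x:{0..1}|lborel. h_fun \<epsilon> (t * x) / x * (1 - x)) \<le> t ^ 2"
    if "0 \<le> t" for t
    unfolding first_integral(2)[OF that] using assms by (intro mult_left_le) auto
  have premise: "khabibullin_premise 2 2 (h_fun \<epsilon>)"
    unfolding khabibullin_premise_def
  proof (intro allI impI)
    fix t :: real assume t: "0 \<le> t"
    have "(\<integral>\<^sup>+x\<in>{0..1}. ennreal (h_fun \<epsilon> (t * x) / x * (1 - x)) \<partial>lborel)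
        = ennreal (LINT x:{0..1}|lborel. h_fun \<epsilon> (t * x) / x * (1 - x))"
      using t nonneg by (intro set_nn_integral_eq_set_integral first_integral(1)) auto
    also have "\<dots> \<le> ennreal (t powr 2)"
      using t first_le by (intro ennreal_leI) simp
    finally show "(\<integral>\<^sup>+x\<in>{0..1}. ennreal (h_fun \<epsilon> (t * x) / x * (1 - x) ^ (2 - 1)) \<partial>lborel)
        \<le> ennreal (t powr 2)" by simp
  qed
  have "(\<integral>\<^sup>+t\<in>{0..}. ennreal (h_fun \<epsilon> t / t * (1 / (1 + t powr (2 * 2)))) \<partial>lborel)
      = (\<integral>\<^sup>+t\<in>{0..}. ennreal (h_fun \<epsilon> t / t * (1 / (1 + t ^ 4))) \<partial>lborel)"
    by (intro nn_integral_cong) (auto simp: indicator_def)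
  also have "\<dots> = ennreal (LINT t:{0..}|lborel. h_fun \<epsilon> t / t * (1 / (1 + t ^ 4)))"
    using nonneg assms by (intro set_nn_integral_eq_set_integral second_integral(1)) auto
  also have "\<dots> > ennreal (3 * pi / 2)"
    using second_integral(2)[OF assms(1)] pi_gt_zero by (intro ennreal_lessI) linarith+
  finally have "\<not> khabibullin_conclusion 2 2 (h_fun \<epsilon>)"
    unfolding khabibullin_conclusion_def by (simp add: not_le mult.commute)
  then have "khabibullin_counterexample 2 2 (h_fun \<epsilon>)"
    unfolding khabibullin_counterexample_def using nonneg mono premise by simp
  then show ?thesis
    using nonneg mono first_le first_integral(1) second_integral[OF assms(1)] by (simp add: not_le)
qed

end
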